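(* Let $V$ be a closed isometric operator in a Hilbert space $H$, and let $\mathbf{R}_z(V)$ be an arbitrary generalized resolvent of $V$. Let $\{\lambda_k\}_{k=1}^\infty$ be a sequence of points of $\mathbb{D}$ such that $\lambda_k\to\widehat\lambda$ as $k\to\infty$, where $\widehat\lambda\in\mathbb{T}$. For each $z\in\mathbb{D}\setminus\{0\}$ let $C(\lambda;z)\in\mathcal{S}(N_z;N_{1/\overline{z}})$ denote the function corresponding to $\mathbf{R}_z(V)$ by Inin's formula with base point $z$. Suppose that for some $z_0\in\mathbb{D}\setminus\{0\}$ the limit in the uniform operator (norm) topology $$\lim_{k\to\infty} C(\lambda_k;z_0)=:C(\widehat\lambda;z_0)$$ exists. Then for arbitrary $z_0'\in\mathbb{D}\setminus\{0\}$ the limit in the uniform operator topology $$\lim_{k\to\infty} C(\lambda_k;z_0')=:C(\widehat\lambda;z_0')$$ exists. In this case $C(\widehat\lambda;z_0')$ is a linear contraction which maps $N_{z_0'}$ into $N_{1/\overline{z_0'}}$, and the corresponding orthogonal extension $V_{C(\widehat\lambda;z_0');z_0'}$ does not depend on the choice of $z_0'\in\mathbb{D}\setminus\{0\}$.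
   Context: All Hilbert spaces are complex and separable. $\mathbb{D}=\{|z|<1\}$, $\mathbb{T}=\{|z|=1\}$, $\mathbb{T}_e=\{z\in\mathbb{C}:|z|\neq1\}$. A closed isometric operator $V$ in $H$ is a linear isometry defined on a closed subspace $D(V)\subseteq H$ with range $R(V)\subseteq H$. $E_H$ is the identity on $H$. Generalized resolvent: if $U\supseteq V$ is a unitary operator in a Hilbert space $\widetilde H\supseteq H$, the function $\mathbf{R}_\zeta h=P^{\widetilde H}_H(E_{\widetilde H}-\zeta U)^{-1}h$, $h\in H$, $\zeta\in\mathbb{T}_e$, is a generalized resolvent of $V$ ($P^{\widetilde H}_H$ is the orthogonal projection onto $H$). Set $M_\zeta=(E_H-\zeta V)D(V)$, $N_\zeta=H\ominus M_\zeta$ for $\zeta\in\mathbb{C}$ ($\ominus$ denotes the orthogonal complement). For $z\in\mathbb{D}$ put $V_z=(V-\overline z E_H)(E_H-zV)^{-1}$, an isometric operator with domain $M_z$ and range $M_{1/\overline z}$. Let $z_0\in\mathbb{D}\setminus\{0\}$ and let $C$ be a linear contraction with $D(C)=N_{z_0}$, $R(C)\subseteq N_{1/\overline{z_0}}$. Set $V^+_{z_0;C}=V_{z_0}\oplus C$ (a bounded operator on all of $H=M_{z_0}\oplus N_{z_0}$) and $$V_{C;z_0}=(V^+_{z_0;C}+\overline{z_0}E_H)(E_H+z_0V^+_{z_0;C})^{-1},$$ called the orthogonal extension of $V$ defined by $C$. $\mathcal{S}(H_1;H_2)$ is the set of all analytic operator-valued functions $F$ on $\mathbb{D}$ whose values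 $F(\zeta)$ are linear contractions with domain $H_1$ and range contained in $H_2$. Inin's formula (known): for each fixed $z_0\in\mathbb{D}$, $$\mathbf{R}_\zeta=\left[E_H-\zeta V_{C(\zeta;z_0);z_0}\right]^{-1},\quad \zeta\in\mathbb{D},$$ establishes a one-to-one correspondence between all generalized resolvents of $V$ and all functions $C(\zeta)=C(\zeta;z_0)\in\mathcal{S}(N_{z_0};N_{1/\overline{z_0}})$. *)

theory Defs
  imports "HOL-Analysis.Analysis"
begin

text \<open>
  Complex inner product spaces are built on \<open>real_inner\<close>: the real inner product is the real part
  of the complex one, so the norm is \<open>sqrt (Re (cinner x x))\<close>. As in the operator theory
  literature, \<open>cinner\<close> is linear in its first argument.
\<close>

class complex_inner = real_inner +
  fixes scaleC :: "complex \<Rightarrow> 'a \<Rightarrow> 'a"  (infixr \<open>*\<^sub>C\<close> 75)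
    and cinner :: "'a \<Rightarrow> 'a \<Rightarrow> complex"
  assumes scaleC_add_right: "a *\<^sub>C (x + y) = a *\<^sub>C x + a *\<^sub>C y"
    and scaleC_add_left: "(a + b) *\<^sub>C x = a *\<^sub>C x + b *\<^sub>C x"
    and scaleC_scaleC: "a *\<^sub>C b *\<^sub>C x = (a * b) *\<^sub>C x"
    and scaleR_scaleC: "r *\<^sub>R x = complex_of_real r *\<^sub>C x"
    and cinner_commute: "cinner x y = cnj (cinner y x)"
    and cinner_add_left: "cinner (x + y) z = cinner x z + cinner y z"
    and cinner_scaleC_left: "cinner (a *\<^sub>C x) y = a * cinner x y"
    and inner_eq_Re_cinner: "inner x y = Re (cinner x y)"

text \<open>For metric spaces \<open>second_countable_topology\<close> is separability.\<close>

class separable_complex_hilbert = complex_inner + complete_space + second_countable_topology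

instantiation complex :: separable_complex_hilbert
begin

definition scaleC_complex :: "complex \<Rightarrow> complex \<Rightarrow> complex"
  where "scaleC_complex a x = a * x"

definition cinner_complex :: "complex \<Rightarrow> complex \<Rightarrow> complex"
  where "cinner_complex x y = x * cnj y"

instance
  by standard
    (simp_all add: scaleC_complex_def cinner_complex_def inner_complex_def algebra_simps
      scaleR_conv_of_real)

end

global_interpretation complex_vector: vector_space "scaleC :: complex \<Rightarrow> 'a \<Rightarrow> 'a::complex_inner"
proof
  show "1 *\<^sub>C x = x" for x :: 'a
    using scaleR_scaleC[of 1 x] by simp
qed (simp_all add: scaleC_add_right scaleC_add_left scaleC_scaleC)

definition orth_compl :: "'a::complex_inner set \<Rightarrow> 'a set"
  where "orth_compl S = {x. \<forall>y\<in>S. cinner x y = 0}"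

definition orth_proj :: "'a::complex_inner set \<Rightarrow> 'a \<Rightarrow> 'a"
  where "orth_proj S x = (THE y. y \<in> S \<and> x - y \<in> orth_compl S)"

text \<open>
  An operator with domain \<open>S\<close> is represented by a total function together with the set \<open>S\<close>; its
  values outside \<open>S\<close> carry no information and are never used.
\<close>

definition clinear_on ::
  "'a::complex_inner set \<Rightarrow> ('a \<Rightarrow> 'b::complex_inner) \<Rightarrow> bool"
  where "clinear_on S T \<longleftrightarrow>
    (\<forall>x\<in>S. \<forall>y\<in>S. T (x + y) = T x + T y) \<and> (\<forall>a. \<forall>x\<in>S. T (a *\<^sub>C x) = a *\<^sub>C T x)"

definition bounded_op_on ::
  "'a::complex_inner set \<Rightarrow> ('a \<Rightarrow> 'b::complex_inner) \<Rightarrow> bool"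
  where "bounded_op_on S T \<longleftrightarrow> clinear_on S T \<and> (\<exists>K. \<forall>x\<in>S. norm (T x) \<le> K * norm x)"

definition op_norm_on ::
  "'a::complex_inner set \<Rightarrow> ('a \<Rightarrow> 'b::complex_inner) \<Rightarrow> real"
  where "op_norm_on S T = (SUP x\<in>S \<inter> cball 0 1. norm (T x))"

text \<open>Convergence in the uniform operator topology of the bounded operators with domain \<open>S\<close>.\<close>

definition op_norm_tendsto ::
  "'a::complex_inner set \<Rightarrow> ('i \<Rightarrow> 'a \<Rightarrow> 'b::complex_inner) \<Rightarrow> ('a \<Rightarrow> 'b) \<Rightarrow> 'i filter \<Rightarrow> bool"
  where "op_norm_tendsto S T L F \<longleftrightarrow>
    (\<forall>\<^sub>F i in F. bounded_op_on S (T i)) \<and> bounded_op_on S L \<and>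
    ((\<lambda>i. op_norm_on S (\<lambda>x. T i x - L x)) \<longlongrightarrow> 0) F"

definition contraction_op ::
  "'a::complex_inner set \<Rightarrow> 'b::complex_inner set \<Rightarrow> ('a \<Rightarrow> 'b) \<Rightarrow> bool"
  where "contraction_op H1 H2 T \<longleftrightarrow>
    clinear_on H1 T \<and> T ` H1 \<subseteq> H2 \<and> (\<forall>x\<in>H1. norm (T x) \<le> norm x)"

text \<open>
  The class \<open>\<S>(H1;H2)\<close>. Analyticity is complex differentiability on the unit disc with respect to
  the operator norm.
\<close>

definition schur_class ::
  "'a::complex_inner set \<Rightarrow> 'b::complex_inner set \<Rightarrow> (complex \<Rightarrow> 'a \<Rightarrow> 'b) set"
  where "schur_class H1 H2 = {F.
    (\<forall>\<zeta>\<in>ball 0 1. contraction_op H1 H2 (F \<zeta>)) \<and>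
    (\<forall>\<zeta>\<in>ball 0 1. \<exists>F'.
      op_norm_tendsto H1 (\<lambda>w x. inverse (w - \<zeta>) *\<^sub>C (F w x - F \<zeta> x)) F' (at \<zeta>))}"

definition closed_isometric_op :: "'a::separable_complex_hilbert set \<Rightarrow> ('a \<Rightarrow> 'a) \<Rightarrow> bool"
  where "closed_isometric_op D V \<longleftrightarrow>
    complex_vector.subspace D \<and> closed D \<and> clinear_on D V \<and> (\<forall>x\<in>D. norm (V x) = norm x)"

definition M_space :: "'a::complex_inner set \<Rightarrow> ('a \<Rightarrow> 'a) \<Rightarrow> complex \<Rightarrow> 'a set"
  where "M_space D V \<zeta> = (\<lambda>h. h - \<zeta> *\<^sub>C V h) ` D"

definition N_space :: "'a::complex_inner set \<Rightarrow> ('a \<Rightarrow> 'a) \<Rightarrow> complex \<Rightarrow> 'a set"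
  where "N_space D V \<zeta> = orth_compl (M_space D V \<zeta>)"

text \<open>The operator \<open>V\<^sub>z\<close>, with domain \<open>M_space D V z\<close>.\<close>

definition moebius_op :: "'a::complex_inner set \<Rightarrow> ('a \<Rightarrow> 'a) \<Rightarrow> complex \<Rightarrow> 'a \<Rightarrow> 'a"
  where "moebius_op D V z =
    (\<lambda>h. V h - cnj z *\<^sub>C h) \<circ> inv_into D (\<lambda>h. h - z *\<^sub>C V h)"

text \<open>The operator \<open>V\<^sub>z \<oplus> C\<close> on the whole space, \<open>C\<close> having domain \<open>N_space D V z\<close>.\<close>

definition moebius_plus ::
  "'a::complex_inner set \<Rightarrow> ('a \<Rightarrow> 'a) \<Rightarrow> complex \<Rightarrow> ('a \<Rightarrow> 'a) \<Rightarrow> 'a \<Rightarrow> 'a"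
  where "moebius_plus D V z C h =
    moebius_op D V z (orth_proj (M_space D V z) h) + C (orth_proj (N_space D V z) h)"

definition orth_extension ::
  "'a::complex_inner set \<Rightarrow> ('a \<Rightarrow> 'a) \<Rightarrow> complex \<Rightarrow> ('a \<Rightarrow> 'a) \<Rightarrow> 'a \<Rightarrow> 'a"
  where "orth_extension D V z C =
    (\<lambda>h. moebius_plus D V z C h + cnj z *\<^sub>C h) \<circ> inv (\<lambda>h. h + z *\<^sub>C moebius_plus D V z C h)"

definition isometric_embedding :: "('a::complex_inner \<Rightarrow> 'b::complex_inner) \<Rightarrow> bool"
  where "isometric_embedding J \<longleftrightarrow> clinear_on UNIV J \<and> (\<forall>x. norm (J x) = norm x)"

definition unitary_op :: "('b::complex_inner \<Rightarrow> 'b) \<Rightarrow> bool"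
  where "unitary_op U \<longleftrightarrow> clinear_on UNIV U \<and> surj U \<and> (\<forall>x. norm (U x) = norm x)"

text \<open>
  \<open>R\<close> is the generalized resolvent of \<open>V\<close> given by the unitary extension \<open>U\<close> acting in the larger
  Hilbert space \<open>'b\<close>. The inclusion of the original space in \<open>'b\<close> is an isometric embedding \<open>J\<close>,
  with \<open>J h\<close> in the role of \<open>h\<close>. Quantifying a theorem over \<open>'b\<close>, \<open>J\<close> and \<open>U\<close> makes \<open>R\<close> an
  arbitrary generalized resolvent.
\<close>

definition generalized_resolvent ::
  "('a::separable_complex_hilbert \<Rightarrow> 'b::separable_complex_hilbert) \<Rightarrow> ('b \<Rightarrow> 'b) \<Rightarrow>
   'a set \<Rightarrow> ('a \<Rightarrow> 'a) \<Rightarrow> (complex \<Rightarrow> 'a \<Rightarrow> 'a) \<Rightarrow> bool"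
  where "generalized_resolvent J U D V R \<longleftrightarrow>
    isometric_embedding J \<and> unitary_op U \<and> (\<forall>h\<in>D. U (J h) = J (V h)) \<and>
    (\<forall>\<zeta>. norm \<zeta> \<noteq> 1 \<longrightarrow>
      (\<forall>h. J (R \<zeta> h) = orth_proj (range J) (inv (\<lambda>x. x - \<zeta> *\<^sub>C U x) (J h))))"

text \<open>
  \<open>F\<close> is the function that corresponds to \<open>R\<close> by Inin's formula with base point \<open>z\<close>
  (for a generalized resolvent \<open>R\<close> it exists and its values are unique as operators with domain
  \<open>N_space D V z\<close>).
\<close>

definition inin_function ::
  "'a::separable_complex_hilbert set \<Rightarrow> ('a \<Rightarrow> 'a) \<Rightarrow> (complex \<Rightarrow> 'a \<Rightarrow> 'a) \<Rightarrow> complex \<Rightarrow>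
   (complex \<Rightarrow> 'a \<Rightarrow> 'a) \<Rightarrow> bool"
  where "inin_function D V R z F \<longleftrightarrow>
    F \<in> schur_class (N_space D V z) (N_space D V (1 / cnj z)) \<and>
    (\<forall>\<zeta>\<in>ball 0 1. R \<zeta> = inv (\<lambda>h. h - \<zeta> *\<^sub>C orth_extension D V z (F \<zeta>) h))"

end

theory Submission
  imports Defs
begin

text \<open>
  The parameter \<open>C(\<zeta>;z)\<close> and the extension \<open>T(\<zeta>) = V\<^bsub>C(\<zeta>;z);z\<^esub>\<close> determine each other by
  transformations that are continuous in the operator norm, while \<open>T(\<zeta>)\<close> does not depend on the
  base point \<open>z\<close>. So \<open>T\<close> carries convergence from one base point to any other.

  The independence of \<open>z\<close> comes from the resolvent: for \<open>\<zeta> \<noteq> 0\<close> the operator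
  \<open>R(\<zeta>) = (1 - \<zeta> T(\<zeta>))\<^sup>-\<^sup>1\<close> determines \<open>T(\<zeta>)\<close> (\<open>contraction_determined_by_resolvent\<close>), and the
  points of a sequence that tends to the unit circle are eventually different from \<open>0\<close>.

  For the continuity, let \<open>W = V\<^sub>z \<oplus> C\<close>. It is a contraction of the whole space
  (\<open>contraction_moebius_plus\<close>), it depends on \<open>C\<close> without increasing distances, and \<open>C\<close> is its
  restriction to \<open>N_space D V z\<close>. The extension is the transform \<open>(W + cnj z) (1 + z W)\<^sup>-\<^sup>1\<close>.
  As for disc automorphisms, this transform maps contractions to contractions
  (\<open>contraction_cayley\<close>) and is inverted by the one with parameter \<open>-z\<close> (\<open>cayley_inverse\<close>). Both
  are Lipschitz with constant \<open>2 / (1 - \<bar>z\<bar>)\<close> (\<open>cayley_lipschitz\<close>).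

  Hence the limit \<open>L\<close> at \<open>z\<^sub>0\<close>, which is again a contraction between the same closed subspaces
  (\<open>contraction_op_limit\<close>), makes \<open>T(\<lambda>\<^sub>k)\<close> converge to its extension
  (\<open>op_norm_tendsto_orth_extension\<close>); then the parameters at any other \<open>z\<close> converge
  (\<open>op_norm_tendsto_parameter\<close>), and the extension of their limit is \<open>lim T(\<lambda>\<^sub>k)\<close> for every \<open>z\<close>.
\<close>

section \<open>Complex inner products\<close>

lemma cinner_scaleC_right: "cinner x (a *\<^sub>C y) = cnj a * cinner x y"
  using cinner_commute[of x "a *\<^sub>C y"] cinner_commute[of x y] by (simp add: cinner_scaleC_left)

text \<open>Replacing \<open>y\<close> by \<open>\<i> y\<close> turns the real part of \<open>cinner x y\<close> into its imaginary part.\<close>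

lemma cinner_eq_0_if_inner_eq_0:
  assumes "inner x y = 0" and "inner x (\<i> *\<^sub>C y) = 0"
  shows "cinner x y = 0"
  using assms by (simp add: inner_eq_Re_cinner cinner_scaleC_right complex_eq_iff)

lemma norm_scaleC: "norm (a *\<^sub>C x) = norm a * norm (x :: 'a::complex_inner)"
proof -
  have "Im (cinner x x) = 0"
    using arg_cong[OF cinner_commute[of x x], of Im] by simp
  then have "(norm (a *\<^sub>C x))\<^sup>2 = (norm a * norm x)\<^sup>2"
    unfolding power_mult_distrib power2_norm_eq_inner[where 'a = 'a]
    by (simp add: inner_eq_Re_cinner cinner_scaleC_left cinner_scaleC_right cmod_def
        power2_eq_square algebra_simps)
  then show ?thesis
    by (simp add: power2_eq_iff_nonneg)
qed

lemma norm_add_scaleC_power2: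
  "(norm (x + a *\<^sub>C y))\<^sup>2 = (norm x)\<^sup>2 + (norm a)\<^sup>2 * (norm y)\<^sup>2 + 2 * Re (cnj a * cinner x y)"
proof -
  have "(norm (x + a *\<^sub>C y))\<^sup>2 = (norm x)\<^sup>2 + (norm (a *\<^sub>C y))\<^sup>2 + 2 * inner x (a *\<^sub>C y)"
    by (simp add: power2_norm_eq_inner inner_add_left inner_add_right inner_commute)
  also have "inner x (a *\<^sub>C y) = Re (cnj a * cinner x y)"
    by (simp add: inner_eq_Re_cinner cinner_scaleC_right)
  finally show ?thesis
    by (simp add: norm_scaleC power_mult_distrib)
qed

text \<open>
  The operator counterpart of the identity
  \<open>\<bar>1 + z w\<bar>\<^sup>2 - \<bar>w + cnj z\<bar>\<^sup>2 = (1 - \<bar>z\<bar>\<^sup>2) (1 - \<bar>w\<bar>\<^sup>2)\<close>: the cross terms on the left are complex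
  conjugates of each other and cancel. It is the reason why disc automorphisms preserve isometries
  and contractions.
\<close>

lemma moebius_norm_identity:
  "(norm (x + z *\<^sub>C y))\<^sup>2 - (norm (y + cnj z *\<^sub>C x))\<^sup>2
    = (1 - (norm z)\<^sup>2) * ((norm x)\<^sup>2 - (norm y)\<^sup>2)"
proof -
  have "Re (cnj z * cinner x y) = Re (z * cinner y x)"
    using cinner_commute[of x y] by simp
  then show ?thesis
    unfolding norm_add_scaleC_power2 by (simp add: algebra_simps)
qed

lemmas scaleC_simps =
  complex_vector.scale_right_distrib complex_vector.scale_left_distrib
  complex_vector.scale_right_diff_distrib complex_vector.scale_left_diff_distrib
  complex_vector.scale_minus_left complex_vector.scale_minus_right
  complex_vector.scale_scale complex_vector.scale_one complex_vector.scale_zero_left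

lemma clinear_on_add: "clinear_on S T \<Longrightarrow> x \<in> S \<Longrightarrow> y \<in> S \<Longrightarrow> T (x + y) = T x + T y"
  and clinear_on_scaleC: "clinear_on S T \<Longrightarrow> x \<in> S \<Longrightarrow> T (a *\<^sub>C x) = a *\<^sub>C T x"
  by (simp_all add: clinear_on_def)

lemma clinear_on_diff:
  assumes "complex_vector.subspace S" "clinear_on S T" "x \<in> S" "y \<in> S"
  shows "T (x - y) = T x - T y"
  using clinear_on_add[OF assms(2), of "x - y" y] assms
  by (simp add: complex_vector.subspace_diff)

section \<open>Orthogonal projections in a Hilbert space\<close>

text \<open>
  A sequence in \<open>S\<close> that minimises the distance to \<open>x\<close> is Cauchy by the parallelogram law, and
  moving away from its limit along \<open>S\<close> cannot decrease the distance to \<open>x\<close>, which forces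
  orthogonality.
\<close>

lemma closed_subspace_orthogonal_decomposition:
  fixes S :: "'a::{real_inner,complete_space} set"
  assumes S: "subspace S" "closed S"
  obtains y where "y \<in> S" "\<And>s. s \<in> S \<Longrightarrow> inner (x - y) s = 0"
proof -
  define d where "d = infdist x S"
  have ne: "S \<noteq> {}" and d0: "d \<ge> 0"
    using S subspace_0 by (auto simp: d_def infdist_nonneg)
  have d_le: "d \<le> norm (x - s)" if "s \<in> S" for s
    using infdist_le[OF that, of x] by (simp add: d_def dist_norm)
  have "\<exists>s\<in>S. dist x s < d + 1 / Suc n" for n
  proof (rule ccontr)
    assume "\<not> ?thesis"
    then have "d + 1 / Suc n \<le> infdist x S"
      unfolding infdist_notempty[OF ne] by (intro cINF_greatest ne) (auto simp: not_less)
    then show False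
      by (simp add: d_def)
  qed
  then obtain s where s: "\<And>n. s n \<in> S" "\<And>n. dist x (s n) < d + 1 / Suc n"
    by metis
  have gap: "(norm (s m - s n))\<^sup>2 \<le> (8 * d + 4) / Suc N" if "m \<ge> N" "n \<ge> N" for m n N
  proof -
    define e where "e = 1 / real (Suc N)"
    have e: "0 < e" "e \<le> 1"
      by (auto simp: e_def)
    have close: "(norm (x - s k))\<^sup>2 \<le> (d + e)\<^sup>2" if "k \<ge> N" for k
    proof -
      have "1 / real (Suc k) \<le> e"
        using that by (simp add: e_def field_simps)
      then show ?thesis
        using s(2)[of k] by (intro power_mono) (auto simp: dist_norm)
    qed
    have "(1 / 2) *\<^sub>R (s m + s n) \<in> S"
      using S s(1) by (simp add: subspace_add subspace_scale)
    then have "d\<^sup>2 \<le> (norm (x - (1 / 2) *\<^sub>R (s m + s n)))\<^sup>2"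
      using d_le d0 by (intro power_mono)
    \<comment> \<open>parallelogram law for \<open>x - s m\<close> and \<open>x - s n\<close>; the midpoint of \<open>s m\<close> and \<open>s n\<close> lies in \<open>S\<close>\<close>
    moreover have "(norm (s m - s n))\<^sup>2 =
        2 * (norm (x - s m))\<^sup>2 + 2 * (norm (x - s n))\<^sup>2 - 4 * (norm (x - (1 / 2) *\<^sub>R (s m + s n)))\<^sup>2"
      by (simp add: power2_norm_eq_inner inner_diff_left inner_diff_right inner_add_left
          inner_add_right inner_commute algebra_simps)
    ultimately have "(norm (s m - s n))\<^sup>2 \<le> 4 * (d + e)\<^sup>2 - 4 * d\<^sup>2"
      using close[OF that(1)] close[OF that(2)] by linarith
    also have "\<dots> = 8 * d * e + 4 * e * e"
      by (simp add: power2_eq_square algebra_simps)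
    also have "\<dots> \<le> 8 * d * e + 4 * e"
      using e by simp
    also have "\<dots> = (8 * d + 4) / Suc N"
      by (simp add: e_def add_divide_distrib)
    finally show ?thesis .
  qed
  have "Cauchy s"
  proof (rule metric_CauchyI)
    fix r :: real assume r: "r > 0"
    obtain N where N: "(8 * d + 4) / r\<^sup>2 < real N"
      using reals_Archimedean2 by blast
    have lt: "(8 * d + 4) / Suc N < r\<^sup>2"
    proof -
      have "8 * d + 4 < r\<^sup>2 * real N"
        using N r by (simp add: field_simps)
      also have "\<dots> \<le> r\<^sup>2 * real (Suc N)"
        by (intro mult_left_mono) auto
      finally show ?thesis
        by (simp add: field_simps)
    qed
    have "dist (s m) (s n) < r" if "m \<ge> N" "n \<ge> N" for m n
    proof -
      have "(norm (s m - s n))\<^sup>2 < r\<^sup>2"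
        using gap[OF that] lt by linarith
      then show ?thesis
        using r by (auto simp: dist_norm intro: power2_less_imp_less)
    qed
    then show "\<exists>M. \<forall>m\<ge>M. \<forall>n\<ge>M. dist (s m) (s n) < r"
      by blast
  qed
  then obtain y where y: "s \<longlonglongrightarrow> y"
    using Cauchy_convergent convergent_def by blast
  then have yS: "y \<in> S"
    using S(2) s(1) closed_sequentially by blast
  have "norm (x - y) \<le> d"
  proof (rule LIMSEQ_le)
    show "(\<lambda>n. norm (x - s n)) \<longlonglongrightarrow> norm (x - y)"
      by (intro tendsto_intros y)
    show "(\<lambda>n. d + 1 / Suc n) \<longlonglongrightarrow> d"
      using tendsto_add[OF tendsto_const[of d] lim_inverse_n'[THEN LIMSEQ_Suc]] by simp
    show "\<exists>N. \<forall>n\<ge>N. norm (x - s n) \<le> d + 1 / Suc n"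
      using s(2) by (auto simp: dist_norm intro: less_imp_le)
  qed
  then have min: "norm (x - y) \<le> norm (x - y')" if "y' \<in> S" for y'
    using d_le[OF that] by simp
  have "inner (x - y) u = 0" if u: "u \<in> S" for u
  proof (cases "u = 0")
    case False
    \<comment> \<open>the step along \<open>u\<close> to the foot of the perpendicular\<close>
    define t where "t = inner (x - y) u / inner u u"
    have "(norm (x - y))\<^sup>2 \<le> (norm (x - (y + t *\<^sub>R u)))\<^sup>2"
      using S u yS by (intro power_mono min) (auto simp: subspace_add subspace_scale)
    also have "\<dots> = (norm (x - y))\<^sup>2 - 2 * t * inner (x - y) u + t * t * inner u u"
      unfolding diff_diff_eq[symmetric] power2_norm_eq_inner inner_diff_left[of "x - y"]
        inner_diff_right[of _ "x - y"]
      by (simp add: inner_commute algebra_simps)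
    also have "t * t * inner u u = t * inner (x - y) u"
      using False by (simp add: t_def)
    finally have "t * inner (x - y) u \<le> 0"
      by (simp add: algebra_simps)
    then have "(inner (x - y) u)\<^sup>2 / inner u u \<le> 0"
      by (simp add: t_def power2_eq_square)
    moreover have "0 < inner u u"
      using False by simp
    ultimately have "(inner (x - y) u)\<^sup>2 \<le> 0"
      by (simp only: pos_divide_le_eq mult_zero_left)
    then show ?thesis
      by simp
  qed simp
  with yS that show ?thesis
    by blast
qed

lemma csubspace_imp_subspace: "complex_vector.subspace S \<Longrightarrow> subspace S"
  by (simp add: complex_vector.subspace_def subspace_def scaleR_scaleC)

lemma subspace_orth_compl: "complex_vector.subspace (orth_compl S)"
  by (auto simp: complex_vector.subspace_def orth_compl_def cinner_add_left cinner_scaleC_left)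
    (metis cinner_scaleC_left complex_vector.scale_zero_left mult_zero_left)

text \<open>
  Over a complex subspace, orthogonality for the real inner product already implies complex
  orthogonality, so the real theory gives closedness and the decomposition.
\<close>

lemma orth_compl_eq_inner:
  assumes "complex_vector.subspace S"
  shows "orth_compl S = (\<Inter>s\<in>S. {x. inner x s = 0})"
  using assms
  by (auto simp: orth_compl_def inner_eq_Re_cinner complex_vector.subspace_scale
      intro!: cinner_eq_0_if_inner_eq_0)

lemma closed_orth_compl: "complex_vector.subspace S \<Longrightarrow> closed (orth_compl S)"
  unfolding orth_compl_eq_inner
  by (intro closed_INT ballI closed_Collect_eq continuous_intros)

lemma orth_compl_orthogonal:
  assumes "x \<in> orth_compl S" "y \<in> S"
  shows "inner x y = 0" "inner y x = 0" "cinner y x = 0"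
  using assms cinner_commute[of y x]
  by (simp_all add: orth_compl_def inner_eq_Re_cinner)

lemma orth_proj_eqI:
  assumes "complex_vector.subspace S" "y \<in> S" "x - y \<in> orth_compl S"
  shows "orth_proj S x = y"
  unfolding orth_proj_def
proof (rule the_equality)
  fix y' assume y': "y' \<in> S \<and> x - y' \<in> orth_compl S"
  then have "(x - y) - (x - y') \<in> orth_compl S" "y' - y \<in> S"
    using assms complex_vector.subspace_diff[OF subspace_orth_compl] complex_vector.subspace_diff
    by blast+
  then show "y' = y"
    using orth_compl_orthogonal(1)[of "y' - y" S "y' - y"] by simp
qed (use assms in simp)

context
  fixes S :: "'a::separable_complex_hilbert set"
  assumes S: "complex_vector.subspace S" "closed S"
begin

lemma orth_proj_in: "orth_proj S x \<in> S"
  and orth_proj_residual: "x - orth_proj S x \<in> orth_compl S"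
proof -
  obtain y where y: "y \<in> S" "\<And>s. s \<in> S \<Longrightarrow> inner (x - y) s = 0"
    using closed_subspace_orthogonal_decomposition[OF csubspace_imp_subspace[OF S(1)] S(2)] by blast
  then have "x - y \<in> orth_compl S"
    by (auto simp: orth_compl_eq_inner[OF S(1)])
  with y(1) show "orth_proj S x \<in> S" "x - orth_proj S x \<in> orth_compl S"
    using orth_proj_eqI[OF S(1)] by metis+
qed

lemma clinear_on_orth_proj: "clinear_on UNIV (orth_proj S)"
  unfolding clinear_on_def
proof (intro conjI ballI allI)
  fix x y :: 'a and a
  show "orth_proj S (x + y) = orth_proj S x + orth_proj S y"
    using complex_vector.subspace_add[OF subspace_orth_compl orth_proj_residual orth_proj_residual,
        of x y]
    by (intro orth_proj_eqI S complex_vector.subspace_add orth_proj_in) (simp add: algebra_simps)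
  show "orth_proj S (a *\<^sub>C x) = a *\<^sub>C orth_proj S x"
    using complex_vector.subspace_scale[OF subspace_orth_compl orth_proj_residual, of a x]
    by (intro orth_proj_eqI S complex_vector.subspace_scale orth_proj_in)
      (simp add: scaleC_simps)
qed

lemma orth_proj_orth_compl: "orth_proj (orth_compl S) x = x - orth_proj S x"
  by (rule orth_proj_eqI)
    (auto simp: subspace_orth_compl orth_proj_residual orth_compl_def[of "orth_compl S"]
      orth_compl_orthogonal(3) orth_proj_in)

lemma norm_orth_proj_pythagoras:
  "(norm x)\<^sup>2 = (norm (orth_proj S x))\<^sup>2 + (norm (orth_proj (orth_compl S) x))\<^sup>2"
proof -
  define p q where "p = orth_proj S x" and "q = x - orth_proj S x"
  then have "inner q p = 0" "inner p q = 0" "x = p + q"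
    using orth_compl_orthogonal[OF orth_proj_residual orth_proj_in, of x x] by simp_all
  then have "(norm x)\<^sup>2 = (norm p)\<^sup>2 + (norm q)\<^sup>2"
    by (simp add: power2_norm_eq_inner inner_add_left inner_add_right)
  then show ?thesis
    by (simp add: orth_proj_orth_compl p_def q_def)
qed

lemma norm_orth_proj_orth_compl_le: "norm (orth_proj (orth_compl S) x) \<le> norm x"
proof (rule power2_le_imp_le)
  show "(norm (orth_proj (orth_compl S) x))\<^sup>2 \<le> (norm x)\<^sup>2"
    unfolding norm_orth_proj_pythagoras[of x] by simp
qed simp

lemma orth_proj_of_orth_compl:
  assumes "x \<in> orth_compl S"
  shows "orth_proj S x = 0" "orth_proj (orth_compl S) x = x"
  using orth_proj_eqI[OF S(1), of 0 x] assms complex_vector.subspace_0[OF S(1)]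
  by (simp_all add: orth_proj_orth_compl)

end

section \<open>The uniform operator topology\<close>

lemma contraction_op_imp_bounded: "contraction_op H1 H2 T \<Longrightarrow> bounded_op_on H1 T"
  unfolding contraction_op_def bounded_op_on_def by (metis mult_1)

lemma bounded_op_on_diff:
  assumes "bounded_op_on S T" "bounded_op_on S L"
  shows "bounded_op_on S (\<lambda>x. T x - L x)"
proof -
  obtain K K' where "\<forall>x\<in>S. norm (T x) \<le> K * norm x" "\<forall>x\<in>S. norm (L x) \<le> K' * norm x"
    using assms by (auto simp: bounded_op_on_def)
  then have "norm (T x - L x) \<le> (K + K') * norm x" if "x \<in> S" for x
    using that norm_triangle_ineq4[of "T x" "L x"] by (fastforce simp: distrib_right)
  moreover have "clinear_on S (\<lambda>x. T x - L x)"
    using assms by (simp add: bounded_op_on_def clinear_on_def scaleC_simps)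
  ultimately show ?thesis
    by (auto simp: bounded_op_on_def)
qed

lemma bdd_above_op_norm:
  assumes "\<And>x. x \<in> S \<Longrightarrow> norm (T x) \<le> K * norm x"
  shows "bdd_above ((\<lambda>x. norm (T x)) ` (S \<inter> cball 0 1))"
proof (rule bdd_aboveI2)
  fix x assume x: "x \<in> S \<inter> cball 0 1"
  then have "norm (T x) \<le> \<bar>K\<bar> * norm x"
    using assms[of x] by (meson IntD1 abs_ge_self mult_right_mono norm_ge_zero order_trans)
  also have "\<dots> \<le> \<bar>K\<bar> * 1"
    using x by (intro mult_left_mono) auto
  finally show "norm (T x) \<le> \<bar>K\<bar>"
    by simp
qed

lemma norm_le_op_norm_on:
  assumes S: "complex_vector.subspace S" and T: "bounded_op_on S T" and x: "x \<in> S"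
  shows "norm (T x) \<le> op_norm_on S T * norm x"
proof (cases "x = 0")
  case True
  then show ?thesis
    using T x by (auto simp: bounded_op_on_def)
next
  case False
  let ?a = "complex_of_real (inverse (norm x))"
  have "norm (T (?a *\<^sub>C x)) \<le> op_norm_on S T"
    unfolding op_norm_on_def
  proof (rule cSUP_upper)
    show "?a *\<^sub>C x \<in> S \<inter> cball 0 1"
      using False x S by (simp add: norm_scaleC norm_inverse complex_vector.subspace_scale)
    show "bdd_above ((\<lambda>x. norm (T x)) ` (S \<inter> cball 0 1))"
      using T by (auto simp: bounded_op_on_def intro: bdd_above_op_norm)
  qed
  moreover have "T (?a *\<^sub>C x) = ?a *\<^sub>C T x"
    using T x by (auto simp: bounded_op_on_def clinear_on_def)
  ultimately show ?thesis
    using False by (simp add: norm_scaleC norm_inverse norm_divide field_simps)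
qed

lemma op_norm_on_bounds:
  assumes "0 \<in> S" "\<And>x. x \<in> S \<Longrightarrow> norm (T x) \<le> K * norm x" "K \<ge> 0"
  shows "0 \<le> op_norm_on S T" "op_norm_on S T \<le> K"
proof -
  have "norm (T 0) \<le> op_norm_on S T"
    unfolding op_norm_on_def
    using assms by (intro cSUP_upper bdd_above_op_norm) auto
  then show "0 \<le> op_norm_on S T"
    by (meson norm_ge_zero order_trans)
  have "norm (T x) \<le> K" if "x \<in> S \<inter> cball 0 1" for x
    using assms(2)[of x] mult_left_mono[of "norm x" 1 K] assms(3) that by auto
  then show "op_norm_on S T \<le> K"
    unfolding op_norm_on_def using assms(1) by (intro cSUP_least) auto
qed

text \<open>
  Estimates are made with error bounds \<open>norm (T i x - L x) \<le> e i * norm x\<close>, where \<open>e\<close> tends to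
  \<open>0\<close>; the next two lemmas translate between them and the operator norm.
\<close>

lemma op_norm_tendstoI:
  assumes "0 \<in> S" "\<forall>\<^sub>F i in F. bounded_op_on S (T i)" "bounded_op_on S L"
    and bound: "\<forall>\<^sub>F i in F. 0 \<le> e i \<and> (\<forall>x\<in>S. norm (T i x - L x) \<le> e i * norm x)"
    and e: "(e \<longlongrightarrow> 0) F"
  shows "op_norm_tendsto S T L F"
proof -
  have "((\<lambda>i. op_norm_on S (\<lambda>x. T i x - L x)) \<longlongrightarrow> 0) F"
  proof (rule tendsto_sandwich[OF _ _ tendsto_const e])
    have "\<forall>\<^sub>F i in F. 0 \<le> op_norm_on S (\<lambda>x. T i x - L x) \<and> op_norm_on S (\<lambda>x. T i x - L x) \<le> e i"
      using bound
    proof eventually_elim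
      case (elim i)
      then show ?case
        using op_norm_on_bounds[OF assms(1), of "\<lambda>x. T i x - L x" "e i"] by blast
    qed
    then show "\<forall>\<^sub>F i in F. 0 \<le> op_norm_on S (\<lambda>x. T i x - L x)"
      "\<forall>\<^sub>F i in F. op_norm_on S (\<lambda>x. T i x - L x) \<le> e i"
      by (auto elim: eventually_mono)
  qed
  with assms show ?thesis
    by (simp add: op_norm_tendsto_def)
qed

lemma op_norm_tendstoE:
  assumes S: "complex_vector.subspace S" and T: "op_norm_tendsto S T L F"
  obtains e where "(e \<longlongrightarrow> 0) F"
    "\<forall>\<^sub>F i in F. 0 \<le> e i \<and> (\<forall>x\<in>S. norm (T i x - L x) \<le> e i * norm x)"
proof
  let ?e = "\<lambda>i. op_norm_on S (\<lambda>x. T i x - L x)"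
  show "((\<lambda>i. \<bar>?e i\<bar>) \<longlongrightarrow> 0) F"
    using T by (intro tendsto_rabs_zero) (simp add: op_norm_tendsto_def)
  have "\<forall>\<^sub>F i in F. bounded_op_on S (T i)" and L: "bounded_op_on S L"
    using T by (auto simp: op_norm_tendsto_def)
  from this(1) show "\<forall>\<^sub>F i in F. 0 \<le> \<bar>?e i\<bar> \<and> (\<forall>x\<in>S. norm (T i x - L x) \<le> \<bar>?e i\<bar> * norm x)"
  proof eventually_elim
    case (elim i)
    show ?case
    proof (intro conjI ballI)
      fix x assume "x \<in> S"
      then have "norm (T i x - L x) \<le> ?e i * norm x"
        using norm_le_op_norm_on[OF S bounded_op_on_diff[OF elim L]] by blast
      also have "\<dots> \<le> \<bar>?e i\<bar> * norm x"
        by (intro mult_right_mono) auto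
      finally show "norm (T i x - L x) \<le> \<bar>?e i\<bar> * norm x" .
    qed simp
  qed
qed

lemma op_norm_tendsto_pointwise:
  assumes "complex_vector.subspace S" "op_norm_tendsto S T L F" "x \<in> S"
  shows "((\<lambda>i. T i x) \<longlongrightarrow> L x) F"
proof -
  obtain e where e: "(e \<longlongrightarrow> 0) F"
      "\<forall>\<^sub>F i in F. 0 \<le> e i \<and> (\<forall>x\<in>S. norm (T i x - L x) \<le> e i * norm x)"
    using op_norm_tendstoE[OF assms(1,2)] by blast
  have "((\<lambda>i. T i x - L x) \<longlongrightarrow> 0) F"
  proof (rule Lim_null_comparison)
    show "\<forall>\<^sub>F i in F. norm (T i x - L x) \<le> e i * norm x"
      using e(2) by eventually_elim (use assms(3) in blast)
    show "((\<lambda>i. e i * norm x) \<longlongrightarrow> 0) F"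
      using tendsto_mult_left_zero[OF e(1)] .
  qed
  then show ?thesis
    by (simp add: LIM_zero_iff)
qed

lemma op_norm_tendsto_UNIV_unique:
  assumes "op_norm_tendsto UNIV T L F" "op_norm_tendsto UNIV T L' F" "F \<noteq> bot"
  shows "L = L'"
  using op_norm_tendsto_pointwise[OF complex_vector.subspace_UNIV] assms
  by (intro ext) (blast intro: tendsto_unique)

lemma op_norm_tendsto_subset:
  fixes L :: "'a::complex_inner \<Rightarrow> 'b::complex_inner"
  assumes "op_norm_tendsto S T L F" "complex_vector.subspace S" "0 \<in> S'" "S' \<subseteq> S"
  shows "op_norm_tendsto S' T L F"
proof -
  obtain e where e: "(e \<longlongrightarrow> 0) F"
      "\<forall>\<^sub>F i in F. 0 \<le> e i \<and> (\<forall>x\<in>S. norm (T i x - L x) \<le> e i * norm x)"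
    using op_norm_tendstoE[OF assms(2,1)] by blast
  have sub: "bounded_op_on S' A" if "bounded_op_on S A" for A :: "'a \<Rightarrow> 'b"
    using that assms(4) unfolding bounded_op_on_def clinear_on_def by blast
  show ?thesis
  proof (rule op_norm_tendstoI[OF assms(3) _ _ _ e(1)])
    show "\<forall>\<^sub>F i in F. bounded_op_on S' (T i)"
      using assms(1) sub by (auto simp: op_norm_tendsto_def elim: eventually_mono)
    show "bounded_op_on S' L"
      using assms(1) sub by (auto simp: op_norm_tendsto_def)
    show "\<forall>\<^sub>F i in F. 0 \<le> e i \<and> (\<forall>x\<in>S'. norm (T i x - L x) \<le> e i * norm x)"
      using e(2) by eventually_elim (use assms(4) in blast)
  qed
qed

lemma bounded_op_on_cong:
  assumes "\<And>x. x \<in> S \<Longrightarrow> T x = T' x" "complex_vector.subspace S"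
  shows "bounded_op_on S T = bounded_op_on S T'"
  using assms
  by (simp add: bounded_op_on_def clinear_on_def complex_vector.subspace_add
      complex_vector.subspace_scale cong: ball_cong)

lemma op_norm_tendsto_cong:
  assumes "\<forall>\<^sub>F i in F. \<forall>x\<in>S. T i x = T' i x" "complex_vector.subspace S"
    and T: "op_norm_tendsto S T L F"
  shows "op_norm_tendsto S T' L F"
proof -
  have "\<forall>\<^sub>F i in F. bounded_op_on S (T i) \<longrightarrow> bounded_op_on S (T' i)"
    using assms(1) by eventually_elim (use assms(2) bounded_op_on_cong in metis)
  moreover have "\<forall>\<^sub>F i in F. op_norm_on S (\<lambda>x. T i x - L x) = op_norm_on S (\<lambda>x. T' i x - L x)"
    using assms(1)
    by eventually_elim (auto simp: op_norm_on_def intro!: arg_cong[where f = Sup] image_cong)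
  ultimately show ?thesis
    using T unfolding op_norm_tendsto_def by (auto elim: eventually_mp intro: Lim_transform_eventually)
qed

lemma contraction_op_limit:
  assumes S: "complex_vector.subspace S" and S': "closed S'"
    and T: "\<And>i. contraction_op S S' (T i)" and lim: "op_norm_tendsto S T L F" "F \<noteq> bot"
  shows "contraction_op S S' L"
  unfolding contraction_op_def
proof (intro conjI ballI)
  note pw = op_norm_tendsto_pointwise[OF S lim(1)]
  show "clinear_on S L"
    using lim by (auto simp: op_norm_tendsto_def bounded_op_on_def)
  show "L ` S \<subseteq> S'"
  proof clarify
    fix x assume "x \<in> S"
    then show "L x \<in> S'"
      using T by (intro Lim_in_closed_set[OF S' _ lim(2) pw] always_eventually)
        (auto simp: contraction_op_def)
  qed
  fix x assume "x \<in> S"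
  then show "norm (L x) \<le> norm x"
    using T by (intro Lim_norm_ubound[OF lim(2) pw] always_eventually)
      (auto simp: contraction_op_def)
qed

section \<open>The Cayley-type transform of a contraction\<close>

abbreviation contraction :: "('a::complex_inner \<Rightarrow> 'a) \<Rightarrow> bool"
  where "contraction \<equiv> contraction_op UNIV UNIV"

lemma contraction_diff: "contraction A \<Longrightarrow> A (x - y) = A x - A y"
  by (rule clinear_on_diff[OF complex_vector.subspace_UNIV])
    (simp_all add: contraction_op_def)

lemma norm_perturbed_identity_ge:
  assumes "norm w \<le> norm h"
  shows "(1 - norm z) * norm h \<le> norm (h + z *\<^sub>C w)"
proof -
  have "norm h - norm (z *\<^sub>C w) \<le> norm (h + z *\<^sub>C w)"
    by (metis diff_minus_eq_add norm_minus_cancel norm_triangle_ineq2)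
  moreover have "norm (z *\<^sub>C w) \<le> norm z * norm h"
    using assms by (simp add: norm_scaleC mult_left_mono)
  ultimately show ?thesis
    by (simp add: algebra_simps)
qed

text \<open>
  Surjectivity is the Banach fixed point theorem for \<open>h \<mapsto> u - z A h\<close>.
\<close>

lemma bij_perturbed_identity:
  fixes A :: "'a::separable_complex_hilbert \<Rightarrow> 'a"
  assumes A: "contraction A" and z: "norm z < 1"
  shows "bij (\<lambda>h. h + z *\<^sub>C A h)"
proof (rule bijI)
  show "inj (\<lambda>h. h + z *\<^sub>C A h)"
  proof (rule injI)
    fix x y assume eq: "x + z *\<^sub>C A x = y + z *\<^sub>C A y"
    have "(1 - norm z) * norm (x - y) \<le> norm ((x - y) + z *\<^sub>C A (x - y))"
      using A by (intro norm_perturbed_identity_ge) (simp add: contraction_op_def)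
    also have "(x - y) + z *\<^sub>C A (x - y) = 0"
      using eq by (simp add: contraction_diff[OF A] scaleC_simps algebra_simps)
    finally show "x = y"
      using z by (simp add: mult_le_0_iff)
  qed
  show "surj (\<lambda>h. h + z *\<^sub>C A h)"
    unfolding surj_def
  proof
    fix u
    have "\<exists>!x. u - z *\<^sub>C A x = x"
    proof (rule banach_fix_type[of "norm z"], use z in simp, use z in simp, intro allI)
      fix x y
      have "dist (u - z *\<^sub>C A x) (u - z *\<^sub>C A y) = norm (z *\<^sub>C A (y - x))"
        by (simp add: dist_norm contraction_diff[OF A] scaleC_simps algebra_simps)
      also have "\<dots> \<le> norm z * norm (y - x)"
        using A by (simp add: norm_scaleC contraction_op_def mult_left_mono)
      finally show "dist (u - z *\<^sub>C A x) (u - z *\<^sub>C A y) \<le> norm z * dist x y"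
        by (simp add: dist_norm norm_minus_commute)
    qed
    then obtain x where "u - z *\<^sub>C A x = x" by blast
    then show "\<exists>h. u = h + z *\<^sub>C A h"
      by (metis diff_add_cancel)
  qed
qed

text \<open>The passage \<open>A \<mapsto> (A + cnj z) (1 + z A)\<^sup>-\<^sup>1\<close> from \<open>V\<^sub>z \<oplus> C\<close> to the extension of \<open>V\<close>.\<close>

definition cayley :: "complex \<Rightarrow> ('a::complex_inner \<Rightarrow> 'a) \<Rightarrow> 'a \<Rightarrow> 'a"
  where "cayley z A = (\<lambda>h. A h + cnj z *\<^sub>C h) \<circ> inv (\<lambda>h. h + z *\<^sub>C A h)"

lemma orth_extension_eq_cayley: "orth_extension D V z C = cayley z (moebius_plus D V z C)"
  by (simp add: orth_extension_def cayley_def)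

context
  fixes z :: complex
  assumes z: "norm z < 1"
begin

lemma cayley_apply:
  fixes A :: "'a::separable_complex_hilbert \<Rightarrow> 'a"
  assumes "contraction A"
  shows "cayley z A (h + z *\<^sub>C A h) = A h + cnj z *\<^sub>C h"
  using inv_f_f[OF bij_is_inj[OF bij_perturbed_identity[OF assms z]], of h]
  by (simp add: cayley_def)

lemma contraction_cayley:
  fixes A :: "'a::separable_complex_hilbert \<Rightarrow> 'a"
  assumes A: "contraction A"
  shows "contraction (cayley z A)"
proof -
  have rep: "\<exists>h. u = h + z *\<^sub>C A h" for u
    using bij_is_surj[OF bij_perturbed_identity[OF A z]] by (meson surjD)
  have add: "A (x + y) = A x + A y" and scale: "A (a *\<^sub>C x) = a *\<^sub>C A x" for x y a
    using A by (simp_all add: contraction_op_def clinear_on_def)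
  have "cayley z A (u + v) = cayley z A u + cayley z A v" for u v
  proof -
    obtain h g where u: "u = h + z *\<^sub>C A h" and v: "v = g + z *\<^sub>C A g"
      using rep by blast
    have uv: "u + v = (h + g) + z *\<^sub>C A (h + g)"
      by (simp add: u v add scaleC_simps algebra_simps)
    have "cayley z A (u + v) = A (h + g) + cnj z *\<^sub>C (h + g)"
      unfolding uv by (rule cayley_apply[OF A])
    also have "\<dots> = cayley z A u + cayley z A v"
      unfolding u v cayley_apply[OF A] by (simp add: add scaleC_simps algebra_simps)
    finally show ?thesis .
  qed
  moreover have "cayley z A (a *\<^sub>C u) = a *\<^sub>C cayley z A u" for a u
  proof -
    obtain h where u: "u = h + z *\<^sub>C A h"
      using rep by blast
    have au: "a *\<^sub>C u = a *\<^sub>C h + z *\<^sub>C A (a *\<^sub>C h)"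
      by (simp add: u scale scaleC_simps mult.commute)
    have "cayley z A (a *\<^sub>C u) = A (a *\<^sub>C h) + cnj z *\<^sub>C a *\<^sub>C h"
      unfolding au by (rule cayley_apply[OF A])
    also have "\<dots> = a *\<^sub>C cayley z A u"
      unfolding u cayley_apply[OF A] by (simp add: scale scaleC_simps mult.commute)
    finally show ?thesis .
  qed
  moreover have "norm (cayley z A u) \<le> norm u" for u
  proof -
    obtain h where u: "u = h + z *\<^sub>C A h"
      using rep by blast
    have "0 \<le> (1 - (norm z)\<^sup>2) * ((norm h)\<^sup>2 - (norm (A h))\<^sup>2)"
      using A z by (simp add: contraction_op_def power_le_one)
    then have "(norm (cayley z A u))\<^sup>2 \<le> (norm u)\<^sup>2"
      unfolding moebius_norm_identity[symmetric] u cayley_apply[OF A] by linarith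
    then show ?thesis
      by (rule power2_le_imp_le) simp
  qed
  ultimately show ?thesis
    by (simp add: contraction_op_def clinear_on_def)
qed

end

text \<open>
  As for the scalar maps \<open>w \<mapsto> (w + cnj z) / (1 + z w)\<close>, the inverse transform is the one with
  parameter \<open>-z\<close>. For \<open>u = h + z A h\<close> and \<open>B\<close> the transform of \<open>A\<close>, the vectors \<open>u - z B u\<close> and
  \<open>B u - cnj z u\<close> are \<open>h\<close> and \<open>A h\<close> multiplied by \<open>1 - \<bar>z\<bar>\<^sup>2\<close>.
\<close>

lemma cayley_inverse:
  fixes A :: "'a::separable_complex_hilbert \<Rightarrow> 'a"
  assumes A: "contraction A" and z: "norm z < 1"
  shows "cayley (-z) (cayley z A) = A"
proof
  fix h
  let ?B = "cayley z A"
  let ?c = "1 - z * cnj z"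
  have z': "norm (-z) < 1"
    using z by simp
  have B: "contraction ?B" and C: "contraction (cayley (-z) ?B)"
    using contraction_cayley[OF z A] contraction_cayley[OF z'] by auto
  define u where "u = h + z *\<^sub>C A h"
  have Bu: "?B u = A h + cnj z *\<^sub>C h"
    using cayley_apply[OF z A] by (simp add: u_def)
  have "cayley (-z) ?B (u + (-z) *\<^sub>C ?B u) = ?B u + cnj (-z) *\<^sub>C u"
    by (rule cayley_apply[OF z' B])
  moreover have "u + (-z) *\<^sub>C ?B u = ?c *\<^sub>C h"
    unfolding Bu by (simp add: u_def scaleC_simps algebra_simps)
  moreover have "?B u + cnj (-z) *\<^sub>C u = ?c *\<^sub>C A h"
    unfolding Bu by (simp add: u_def scaleC_simps algebra_simps)
  ultimately have "cayley (-z) ?B (?c *\<^sub>C h) = ?c *\<^sub>C A h"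
    by simp
  then have "?c *\<^sub>C cayley (-z) ?B h = ?c *\<^sub>C A h"
    using C by (simp add: contraction_op_def clinear_on_def)
  moreover have "?c \<noteq> 0"
  proof -
    have "norm (z * cnj z) < 1"
      using z by (simp add: norm_mult abs_square_less_1 flip: power2_eq_square)
    then show ?thesis
      by auto
  qed
  ultimately show "cayley (-z) ?B h = A h"
    by simp
qed

text \<open>
  The transform is Lipschitz in the operator norm: evaluated at \<open>u = h + z A h\<close>, the transforms of
  \<open>A\<close> and \<open>A'\<close> differ by at most twice the norm of \<open>A h - A' h\<close>, because the transform of \<open>A'\<close> is
  itself a contraction.
\<close>

lemma cayley_lipschitz:
  fixes A A' :: "'a::separable_complex_hilbert \<Rightarrow> 'a"
  assumes A: "contraction A" and A': "contraction A'" and z: "norm z < 1"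
    and e: "0 \<le> e" "\<And>h. norm (A h - A' h) \<le> e * norm h"
  shows "norm (cayley z A u - cayley z A' u) \<le> 2 * e / (1 - norm z) * norm u"
proof -
  obtain h where u: "u = h + z *\<^sub>C A h"
    using bij_is_surj[OF bij_perturbed_identity[OF A z]] by (meson surjD)
  define v where "v = h + z *\<^sub>C A' h"
  note B' = contraction_cayley[OF z A']
  have vu: "norm (v - u) \<le> norm (A h - A' h)"
  proof -
    have "v - u = (-z) *\<^sub>C (A h - A' h)"
      by (simp add: u v_def scaleC_simps algebra_simps)
    then have "norm (v - u) = norm z * norm (A h - A' h)"
      by (simp add: norm_scaleC)
    also have "\<dots> \<le> norm (A h - A' h)"
      using z by (simp add: mult_left_le_one_le)
    finally show ?thesis .
  qed
  have "cayley z A u = A h + cnj z *\<^sub>C h" "cayley z A' v = A' h + cnj z *\<^sub>C h"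
    using cayley_apply[OF z A] cayley_apply[OF z A'] by (simp_all add: u v_def)
  then have "cayley z A u - cayley z A' u = (A h - A' h) + cayley z A' (v - u)"
    by (simp add: contraction_diff[OF B'])
  then have "norm (cayley z A u - cayley z A' u) \<le> norm (A h - A' h) + norm (cayley z A' (v - u))"
    by (simp only: norm_triangle_ineq)
  also have "\<dots> \<le> 2 * norm (A h - A' h)"
    using vu B' by (force simp: contraction_op_def intro: order_trans)
  also have "\<dots> \<le> 2 * e * norm h"
    using e by (simp add: mult.assoc)
  also have "\<dots> \<le> 2 * e * (norm u / (1 - norm z))"
  proof (rule mult_left_mono)
    have "(1 - norm z) * norm h \<le> norm u"
      unfolding u using A by (intro norm_perturbed_identity_ge) (simp add: contraction_op_def)
    then show "norm h \<le> norm u / (1 - norm z)"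
      using z by (simp add: field_simps)
  qed (use e in simp)
  finally show ?thesis
    by simp
qed

lemma op_norm_tendsto_cayley:
  fixes A :: "'i \<Rightarrow> 'a::separable_complex_hilbert \<Rightarrow> 'a"
  assumes A: "\<And>i. contraction (A i)" and L: "contraction L" and z: "norm z < 1"
    and lim: "op_norm_tendsto UNIV A L F"
  shows "op_norm_tendsto UNIV (\<lambda>i. cayley z (A i)) (cayley z L) F"
proof -
  obtain e where e: "(e \<longlongrightarrow> 0) F"
      "\<forall>\<^sub>F i in F. 0 \<le> e i \<and> (\<forall>x\<in>UNIV. norm (A i x - L x) \<le> e i * norm x)"
    using op_norm_tendstoE[OF complex_vector.subspace_UNIV lim] by blast
  show ?thesis
  proof (rule op_norm_tendstoI)
    show "((\<lambda>i. 2 * e i / (1 - norm z)) \<longlongrightarrow> 0) F"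
      using tendsto_divide_zero[OF tendsto_mult_right_zero[OF e(1)]] .
    show "\<forall>\<^sub>F i in F. 0 \<le> 2 * e i / (1 - norm z) \<and>
        (\<forall>x\<in>UNIV. norm (cayley z (A i) x - cayley z L x) \<le> 2 * e i / (1 - norm z) * norm x)"
      using e(2) by eventually_elim (use z cayley_lipschitz[OF A L z] in auto)
    show "\<forall>\<^sub>F i in F. bounded_op_on UNIV (cayley z (A i))" "bounded_op_on UNIV (cayley z L)"
      using contraction_op_imp_bounded[OF contraction_cayley[OF z A]]
        contraction_op_imp_bounded[OF contraction_cayley[OF z L]] by (auto intro: always_eventually)
  qed simp
qed

section \<open>The operator \<open>V\<^sub>z \<oplus> C\<close>\<close>

context
  fixes D :: "'a::separable_complex_hilbert set" and V :: "'a \<Rightarrow> 'a" and z :: complex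
  assumes V: "closed_isometric_op D V" and z: "z \<in> ball 0 1 - {0}"
begin

lemma norm_base_point: "norm z < 1" "z \<noteq> 0"
  using z by auto

lemma isometric_opD:
  "complex_vector.subspace D" "closed D" "clinear_on D V" "x \<in> D \<Longrightarrow> norm (V x) = norm x"
  using V by (auto simp: closed_isometric_op_def)

lemma norm_M_space_param_ge:
  assumes "g \<in> D" "h \<in> D"
  shows "(1 - norm z) * norm (g - h) \<le> norm ((g - z *\<^sub>C V g) - (h - z *\<^sub>C V h))"
proof -
  have gh: "g - h \<in> D"
    using isometric_opD(1) assms complex_vector.subspace_diff by blast
  have "(1 - norm z) * norm (g - h) \<le> norm ((g - h) + (-z) *\<^sub>C V (g - h))"
    using norm_perturbed_identity_ge[of "V (g - h)" "g - h" "-z"] isometric_opD(4)[OF gh] by simp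
  also have "(g - h) + (-z) *\<^sub>C V (g - h) = (g - z *\<^sub>C V g) - (h - z *\<^sub>C V h)"
    by (simp add: clinear_on_diff[OF isometric_opD(1,3) assms] scaleC_simps algebra_simps)
  finally show ?thesis .
qed

lemma subspace_M_space: "complex_vector.subspace (M_space D V a)"
proof (rule complex_vector.subspaceI)
  note [simp] = clinear_on_add[OF isometric_opD(3)] clinear_on_scaleC[OF isometric_opD(3)]
  note D = isometric_opD(1)
  have "0 - a *\<^sub>C V 0 = 0"
    using isometric_opD(4)[OF complex_vector.subspace_0[OF D]] by simp
  then show "0 \<in> M_space D V a"
    unfolding M_space_def using complex_vector.subspace_0[OF D]
    by (intro image_eqI[of _ _ 0]) simp_all
  show "x + y \<in> M_space D V a" if xy: "x \<in> M_space D V a" "y \<in> M_space D V a" for x y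
  proof -
    obtain g h where "g \<in> D" "x = g - a *\<^sub>C V g" "h \<in> D" "y = h - a *\<^sub>C V h"
      using xy by (auto simp: M_space_def)
    then show ?thesis
      unfolding M_space_def
      by (intro image_eqI[of _ _ "g + h"])
        (simp_all add: scaleC_simps complex_vector.subspace_add[OF D])
  qed
  show "b *\<^sub>C x \<in> M_space D V a" if x: "x \<in> M_space D V a" for x b
  proof -
    obtain g where "g \<in> D" "x = g - a *\<^sub>C V g"
      using x by (auto simp: M_space_def)
    then show ?thesis
      unfolding M_space_def
      by (intro image_eqI[of _ _ "b *\<^sub>C g"])
        (simp_all add: scaleC_simps complex_vector.subspace_scale[OF D] mult.commute)
  qed
qed

text \<open>\<open>1 - z V\<close> is bounded below on the closed set \<open>D\<close>, so it has closed range.\<close>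

lemma closed_M_space: "closed (M_space D V z)"
  unfolding closed_sequential_limits
proof (intro allI impI, elim conjE)
  fix x l assume x: "\<forall>n. x n \<in> M_space D V z" and l: "x \<longlonglongrightarrow> l"
  then obtain g where g: "\<And>n. g n \<in> D" "\<And>n. x n = g n - z *\<^sub>C V (g n)"
    unfolding M_space_def image_iff by metis
  have lip: "norm (g m - g n) \<le> norm (x m - x n) / (1 - norm z)" for m n
    using norm_M_space_param_ge[OF g(1) g(1), of m n] norm_base_point
    by (simp add: g(2) field_simps)
  have "Cauchy g"
  proof (rule metric_CauchyI)
    fix r :: real assume "r > 0"
    then have "0 < r * (1 - norm z)"
      using norm_base_point by simp
    then obtain M where M: "\<And>m n. m \<ge> M \<Longrightarrow> n \<ge> M \<Longrightarrow> dist (x m) (x n) < r * (1 - norm z)"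
      using metric_CauchyD[OF LIMSEQ_imp_Cauchy[OF l]] by blast
    have "dist (g m) (g n) < r" if "m \<ge> M" "n \<ge> M" for m n
    proof -
      have "norm (x m - x n) / (1 - norm z) < r"
        using M[OF that] norm_base_point by (simp add: dist_norm field_simps)
      then show ?thesis
        using lip[of m n] by (simp add: dist_norm)
    qed
    then show "\<exists>M. \<forall>m\<ge>M. \<forall>n\<ge>M. dist (g m) (g n) < r"
      by blast
  qed
  then obtain h where h: "g \<longlonglongrightarrow> h"
    using Cauchy_convergent convergent_def by blast
  have hD: "h \<in> D"
    using isometric_opD(2) g(1) h closed_sequentially by blast
  have "(\<lambda>n. x n - (h - z *\<^sub>C V h)) \<longlonglongrightarrow> 0"
  proof (rule Lim_null_comparison)
    show "\<forall>\<^sub>F n in sequentially. norm (x n - (h - z *\<^sub>C V h)) \<le> 2 * norm (g n - h)"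
    proof (intro always_eventually allI)
      fix n
      have gh: "g n - h \<in> D"
        using isometric_opD(1) g(1) hD complex_vector.subspace_diff by blast
      have "x n - (h - z *\<^sub>C V h) = (g n - h) - z *\<^sub>C V (g n - h)"
        by (simp add: g(2) clinear_on_diff[OF isometric_opD(1,3) g(1) hD] scaleC_simps)
      then have "norm (x n - (h - z *\<^sub>C V h)) \<le> norm (g n - h) + norm (z *\<^sub>C V (g n - h))"
        by (simp only: norm_triangle_ineq4)
      also have "\<dots> \<le> 2 * norm (g n - h)"
        using norm_base_point isometric_opD(4)[OF gh]
        by (simp add: norm_scaleC mult_left_le_one_le)
      finally show "norm (x n - (h - z *\<^sub>C V h)) \<le> 2 * norm (g n - h)" .
    qed
    show "(\<lambda>n. 2 * norm (g n - h)) \<longlonglongrightarrow> 0"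
      using h by (intro tendsto_mult_right_zero tendsto_norm_zero) (simp add: LIM_zero)
  qed
  then have "x \<longlonglongrightarrow> h - z *\<^sub>C V h"
    by (simp add: LIM_zero_iff)
  then have "l = h - z *\<^sub>C V h"
    using l LIMSEQ_unique by blast
  then show "l \<in> M_space D V z"
    using hD by (auto simp: M_space_def)
qed

lemma subspace_N_space: "complex_vector.subspace (N_space D V a)"
  by (simp add: N_space_def subspace_orth_compl)

lemma closed_N_space: "closed (N_space D V a)"
  by (simp add: N_space_def closed_orth_compl subspace_M_space)

lemma moebius_op_apply:
  assumes "g \<in> D"
  shows "moebius_op D V z (g - z *\<^sub>C V g) = V g - cnj z *\<^sub>C g"
proof -
  have "inj_on (\<lambda>h. h - z *\<^sub>C V h) D"
  proof (rule inj_onI)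
    fix x y assume "x \<in> D" "y \<in> D" "x - z *\<^sub>C V x = y - z *\<^sub>C V y"
    then show "x = y"
      using norm_M_space_param_ge[of x y] norm_base_point by (simp add: mult_le_0_iff)
  qed
  from inv_into_f_f[OF this assms] show ?thesis
    by (simp add: moebius_op_def)
qed

text \<open>
  \<open>V\<^sub>z\<close> is isometric by \<open>moebius_norm_identity\<close>. Its range lies in \<open>M_space D V (1 / cnj z)\<close> because
  \<open>V g - cnj z g = - cnj z (g - (1 / cnj z) V g)\<close>.
\<close>

lemma contraction_op_moebius_op:
  "contraction_op (M_space D V z) (M_space D V (1 / cnj z)) (moebius_op D V z)"
proof -
  note [simp] = clinear_on_add[OF isometric_opD(3)] clinear_on_scaleC[OF isometric_opD(3)]
  note D = isometric_opD(1)
  have "moebius_op D V z (x + y) = moebius_op D V z x + moebius_op D V z y"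
    if xy: "x \<in> M_space D V z" "y \<in> M_space D V z" for x y
  proof -
    obtain g h where gh: "g \<in> D" "x = g - z *\<^sub>C V g" "h \<in> D" "y = h - z *\<^sub>C V h"
      using xy by (auto simp: M_space_def)
    then have "moebius_op D V z ((g + h) - z *\<^sub>C V (g + h)) = V (g + h) - cnj z *\<^sub>C (g + h)"
      by (intro moebius_op_apply complex_vector.subspace_add D)
    also have "(g + h) - z *\<^sub>C V (g + h) = x + y"
      using gh by (simp add: scaleC_simps)
    also have "V (g + h) - cnj z *\<^sub>C (g + h) = moebius_op D V z x + moebius_op D V z y"
      using gh by (simp add: moebius_op_apply scaleC_simps)
    finally show ?thesis .
  qed
  moreover have "moebius_op D V z (a *\<^sub>C x) = a *\<^sub>C moebius_op D V z x"
    if x: "x \<in> M_space D V z" for a x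
  proof -
    obtain g where g: "g \<in> D" "x = g - z *\<^sub>C V g"
      using x by (auto simp: M_space_def)
    then have "moebius_op D V z (a *\<^sub>C g - z *\<^sub>C V (a *\<^sub>C g)) = V (a *\<^sub>C g) - cnj z *\<^sub>C a *\<^sub>C g"
      by (intro moebius_op_apply complex_vector.subspace_scale D)
    also have "a *\<^sub>C g - z *\<^sub>C V (a *\<^sub>C g) = a *\<^sub>C x"
      using g by (simp add: scaleC_simps mult.commute)
    also have "V (a *\<^sub>C g) - cnj z *\<^sub>C a *\<^sub>C g = a *\<^sub>C moebius_op D V z x"
      using g by (simp add: moebius_op_apply scaleC_simps mult.commute)
    finally show ?thesis .
  qed
  moreover have "moebius_op D V z x \<in> M_space D V (1 / cnj z)"
    and "norm (moebius_op D V z x) \<le> norm x" if x: "x \<in> M_space D V z" for x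
  proof -
    obtain g where g: "g \<in> D" "x = g - z *\<^sub>C V g"
      using x by (auto simp: M_space_def)
    have "moebius_op D V z x = (- cnj z) *\<^sub>C (g - (1 / cnj z) *\<^sub>C V g)"
      using g norm_base_point by (simp add: moebius_op_apply scaleC_simps)
    moreover have "g - (1 / cnj z) *\<^sub>C V g \<in> M_space D V (1 / cnj z)"
      using g by (auto simp: M_space_def)
    ultimately show "moebius_op D V z x \<in> M_space D V (1 / cnj z)"
      by (metis complex_vector.subspace_scale subspace_M_space)
    have "(norm x)\<^sup>2 = (norm (moebius_op D V z x))\<^sup>2"
      using moebius_norm_identity[of g "-z" "V g"] isometric_opD(4)[OF g(1)] g
      by (simp add: moebius_op_apply scaleC_simps)
    then show "norm (moebius_op D V z x) \<le> norm x"
      by simp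
  qed
  ultimately show ?thesis
    by (auto simp: contraction_op_def clinear_on_def)
qed

text \<open>
  The two summands have orthogonal domains and orthogonal ranges, so the squared norms of their
  values add up.
\<close>

lemma contraction_moebius_plus:
  assumes C: "contraction_op (N_space D V z) (N_space D V (1 / cnj z)) C"
  shows "contraction (moebius_plus D V z C)"
proof -
  note M = subspace_M_space[of z] closed_M_space
  note N = subspace_N_space[of z] closed_N_space[of z]
  note V' = contraction_op_moebius_op
  let ?P = "orth_proj (M_space D V z)" and ?Q = "orth_proj (N_space D V z)"
  have P: "?P x \<in> M_space D V z" and Q: "?Q x \<in> N_space D V z" for x
    using orth_proj_in M N by auto
  have "clinear_on UNIV (moebius_plus D V z C)"
    using clinear_on_orth_proj[OF M] clinear_on_orth_proj[OF N] V' C P Q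
    by (simp add: clinear_on_def moebius_plus_def contraction_op_def scaleC_simps)
  moreover have "norm (moebius_plus D V z C x) \<le> norm x" for x
  proof (rule power2_le_imp_le)
    let ?a = "moebius_op D V z (?P x)" and ?b = "C (?Q x)"
    have "?a \<in> M_space D V (1 / cnj z)" "?b \<in> N_space D V (1 / cnj z)"
      using V' C P Q by (auto simp: contraction_op_def)
    then have "inner ?a ?b = 0" "inner ?b ?a = 0"
      using orth_compl_orthogonal by (auto simp: N_space_def)
    then have "(norm (moebius_plus D V z C x))\<^sup>2 = (norm ?a)\<^sup>2 + (norm ?b)\<^sup>2"
      by (simp add: moebius_plus_def power2_norm_eq_inner inner_add_left inner_add_right)
    also have "\<dots> \<le> (norm (?P x))\<^sup>2 + (norm (?Q x))\<^sup>2"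
      using V' C P Q by (intro add_mono power_mono) (auto simp: contraction_op_def)
    also have "\<dots> = (norm x)\<^sup>2"
      unfolding N_space_def by (rule norm_orth_proj_pythagoras[OF M, symmetric])
    finally show "(norm (moebius_plus D V z C x))\<^sup>2 \<le> (norm x)\<^sup>2" .
  qed simp
  ultimately show ?thesis
    by (simp add: contraction_op_def)
qed

lemma moebius_plus_on_N_space:
  assumes x: "x \<in> N_space D V z"
  shows "moebius_plus D V z C x = C x"
proof -
  have "moebius_op D V z 0 = 0 *\<^sub>C moebius_op D V z 0"
    using contraction_op_moebius_op complex_vector.subspace_0[OF subspace_M_space[of z]]
    by (metis clinear_on_scaleC complex_vector.scale_zero_left contraction_op_def)
  then show ?thesis
    using x orth_proj_of_orth_compl[OF subspace_M_space closed_M_space]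
    by (simp add: moebius_plus_def N_space_def)
qed

lemma op_norm_tendsto_moebius_plus:
  assumes C: "\<And>i. contraction_op (N_space D V z) (N_space D V (1 / cnj z)) (C i)"
    and L: "contraction_op (N_space D V z) (N_space D V (1 / cnj z)) L"
    and lim: "op_norm_tendsto (N_space D V z) C L F"
  shows "op_norm_tendsto UNIV (\<lambda>i. moebius_plus D V z (C i)) (moebius_plus D V z L) F"
proof -
  obtain e where e: "(e \<longlongrightarrow> 0) F"
      "\<forall>\<^sub>F i in F. 0 \<le> e i \<and> (\<forall>x\<in>N_space D V z. norm (C i x - L x) \<le> e i * norm x)"
    using op_norm_tendstoE[OF subspace_N_space lim] by blast
  show ?thesis
  proof (rule op_norm_tendstoI[OF _ _ _ _ e(1)])
    show "\<forall>\<^sub>F i in F. 0 \<le> e i \<and>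
        (\<forall>x\<in>UNIV. norm (moebius_plus D V z (C i) x - moebius_plus D V z L x) \<le> e i * norm x)"
      using e(2)
    proof eventually_elim
      case (elim i)
      have "norm (moebius_plus D V z (C i) x - moebius_plus D V z L x) \<le> e i * norm x" for x
      proof -
        let ?q = "orth_proj (N_space D V z) x"
        have "norm (moebius_plus D V z (C i) x - moebius_plus D V z L x) = norm (C i ?q - L ?q)"
          by (simp add: moebius_plus_def)
        also have "\<dots> \<le> e i * norm ?q"
          using elim orth_proj_in[OF subspace_N_space closed_N_space] by blast
        also have "\<dots> \<le> e i * norm x"
          using elim norm_orth_proj_orth_compl_le[OF subspace_M_space closed_M_space]
          by (simp add: N_space_def mult_left_mono)
        finally show ?thesis .
      qed
      with elim show ?case
        by blast
    qed
    show "\<forall>\<^sub>F i in F. bounded_op_on UNIV (moebius_plus D V z (C i))"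
      "bounded_op_on UNIV (moebius_plus D V z L)"
      using contraction_op_imp_bounded[OF contraction_moebius_plus[OF C]]
        contraction_op_imp_bounded[OF contraction_moebius_plus[OF L]]
      by (auto intro: always_eventually)
  qed simp
qed

section \<open>Orthogonal extensions and their parameters\<close>

lemma contraction_orth_extension:
  assumes "contraction_op (N_space D V z) (N_space D V (1 / cnj z)) C"
  shows "contraction (orth_extension D V z C)"
  unfolding orth_extension_eq_cayley
  using contraction_cayley[OF norm_base_point(1) contraction_moebius_plus[OF assms]] .

lemma op_norm_tendsto_orth_extension:
  assumes "\<And>i. contraction_op (N_space D V z) (N_space D V (1 / cnj z)) (C i)"
    and "contraction_op (N_space D V z) (N_space D V (1 / cnj z)) L"
    and "op_norm_tendsto (N_space D V z) C L F"
  shows "op_norm_tendsto UNIV (\<lambda>i. orth_extension D V z (C i)) (orth_extension D V z L) F"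
  unfolding orth_extension_eq_cayley
  by (rule op_norm_tendsto_cayley[OF _ _ _ op_norm_tendsto_moebius_plus[OF assms]])
    (rule contraction_moebius_plus assms norm_base_point)+

text \<open>
  The parameter is recovered continuously from the extension: \<open>C\<close> is the restriction to
  \<open>N_space D V z\<close> of the inverse transform of the extension.
\<close>

lemma op_norm_tendsto_parameter:
  assumes C: "\<And>i. contraction_op (N_space D V z) (N_space D V (1 / cnj z)) (C i)"
    and T: "contraction T"
    and lim: "op_norm_tendsto UNIV (\<lambda>i. orth_extension D V z (C i)) T F"
  shows "op_norm_tendsto (N_space D V z) C (cayley (-z) T) F"
proof -
  have "norm (-z) < 1"
    using norm_base_point by simp
  then have "op_norm_tendsto UNIV (\<lambda>i. cayley (-z) (orth_extension D V z (C i))) (cayley (-z) T) F"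
    by (rule op_norm_tendsto_cayley[OF contraction_orth_extension[OF C] T _ lim])
  then have restricted: "op_norm_tendsto (N_space D V z)
      (\<lambda>i. cayley (-z) (orth_extension D V z (C i))) (cayley (-z) T) F"
    by (rule op_norm_tendsto_subset)
      (simp_all add: complex_vector.subspace_UNIV complex_vector.subspace_0[OF subspace_N_space])
  have param: "cayley (-z) (orth_extension D V z (C i)) x = C i x"
    if "x \<in> N_space D V z" for i x
    using cayley_inverse[OF contraction_moebius_plus[OF C] norm_base_point(1)]
      moebius_plus_on_N_space[OF that]
    by (simp add: orth_extension_eq_cayley)
  have "\<forall>\<^sub>F i in F. \<forall>x\<in>N_space D V z. cayley (-z) (orth_extension D V z (C i)) x = C i x"
    using param by (intro always_eventually) blast
  then show ?thesis
    by (rule op_norm_tendsto_cong[OF _ subspace_N_space restricted])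
qed

end

text \<open>
  A contraction \<open>T\<close> can be read off from \<open>(1 - \<zeta> T)\<^sup>-\<^sup>1\<close> when \<open>\<zeta> \<noteq> 0\<close>, so the resolvent determines
  the extension at \<open>\<zeta>\<close> whatever base point is used.
\<close>

lemma contraction_determined_by_resolvent:
  fixes T T' :: "'a::separable_complex_hilbert \<Rightarrow> 'a"
  assumes T: "contraction T" "contraction T'" and \<zeta>: "norm \<zeta> < 1" "\<zeta> \<noteq> 0"
    and eq: "inv (\<lambda>h. h - \<zeta> *\<^sub>C T h) = inv (\<lambda>h. h - \<zeta> *\<^sub>C T' h)"
  shows "T = T'"
proof -
  have bij: "bij (\<lambda>h. h - \<zeta> *\<^sub>C A h)" if "contraction A" for A :: "'a \<Rightarrow> 'a"
    using bij_perturbed_identity[OF that, of "-\<zeta>"] \<zeta> by (simp add: scaleC_simps)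
  have same: "(\<lambda>h. h - \<zeta> *\<^sub>C T h) = (\<lambda>h. h - \<zeta> *\<^sub>C T' h)"
    using bij[OF T(1)] bij[OF T(2)] eq by (metis inv_inv_eq)
  have "\<zeta> *\<^sub>C T h = \<zeta> *\<^sub>C T' h" for h
    using fun_cong[OF same, of h] by simp
  then show ?thesis
    using \<zeta>(2) by auto
qed

theorem theorem3p1:
  fixes V :: "'a::separable_complex_hilbert \<Rightarrow> 'a"
    and D :: "'a set"
    and J :: "'a \<Rightarrow> 'b::separable_complex_hilbert"
    and U :: "'b \<Rightarrow> 'b"
    and R :: "complex \<Rightarrow> 'a \<Rightarrow> 'a"
    and C :: "complex \<Rightarrow> complex \<Rightarrow> 'a \<Rightarrow> 'a"
    and lam :: "nat \<Rightarrow> complex"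
    and lamhat z0 :: complex
  assumes "closed_isometric_op D V"
    and "generalized_resolvent J U D V R"
    and "\<forall>z\<in>ball 0 1 - {0}. inin_function D V R z (\<lambda>\<zeta>. C \<zeta> z)"
    and "\<forall>k. lam k \<in> ball 0 1"
    and "lam \<longlonglongrightarrow> lamhat"
    and "lamhat \<in> sphere 0 1"
    and "z0 \<in> ball 0 1 - {0}"
    and "\<exists>L. op_norm_tendsto (N_space D V z0) (\<lambda>k. C (lam k) z0) L sequentially"
  shows "(\<forall>z\<in>ball 0 1 - {0}.
            \<exists>L. op_norm_tendsto (N_space D V z) (\<lambda>k. C (lam k) z) L sequentially) \<and>
         (\<forall>z\<in>ball 0 1 - {0}. \<forall>L.
            op_norm_tendsto (N_space D V z) (\<lambda>k. C (lam k) z) L sequentially \<longrightarrow>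
              contraction_op (N_space D V z) (N_space D V (1 / cnj z)) L) \<and>
         (\<forall>z\<in>ball 0 1 - {0}. \<forall>w\<in>ball 0 1 - {0}. \<forall>L L'.
            op_norm_tendsto (N_space D V z) (\<lambda>k. C (lam k) z) L sequentially \<longrightarrow>
            op_norm_tendsto (N_space D V w) (\<lambda>k. C (lam k) w) L' sequentially \<longrightarrow>
              orth_extension D V z L = orth_extension D V w L')"
proof -
  define N where "N = N_space D V"
  note V = assms(1)
  have contr: "contraction_op (N z) (N (1 / cnj z)) (C (lam k) z)" if "z \<in> ball 0 1 - {0}" for z k
    using assms(3,4) that by (auto simp: inin_function_def schur_class_def N_def)
  have lim_contr: "contraction_op (N z) (N (1 / cnj z)) L"
    if z: "z \<in> ball 0 1 - {0}" and "op_norm_tendsto (N z) (\<lambda>k. C (lam k) z) L sequentially" for z L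
    using that(2) unfolding N_def
    by (rule contraction_op_limit[OF subspace_N_space[OF V z] closed_N_space[OF V z]
          contr[OF z, unfolded N_def]]) simp
  \<comment> \<open>Inin's formula at the point \<open>0\<close> carries no information, but \<open>lam k\<close> tends to the unit circle.\<close>
  have "\<forall>\<^sub>F k in sequentially. lam k \<in> - {0}"
    using assms(5,6) by (intro topological_tendstoD) auto
  then have same: "\<forall>\<^sub>F k in sequentially. \<forall>h\<in>UNIV.
      orth_extension D V z (C (lam k) z) h = orth_extension D V w (C (lam k) w) h"
    if z: "z \<in> ball 0 1 - {0}" and w: "w \<in> ball 0 1 - {0}" for z w
  proof eventually_elim
    case (elim k)
    have R: "R (lam k) = inv (\<lambda>h. h - lam k *\<^sub>C orth_extension D V v (C (lam k) v) h)"
      if "v \<in> ball 0 1 - {0}" for v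
      using assms(3,4) that by (auto simp: inin_function_def)
    have "orth_extension D V z (C (lam k) z) = orth_extension D V w (C (lam k) w)"
    proof (rule contraction_determined_by_resolvent)
      show "norm (lam k) < 1" "lam k \<noteq> 0"
        using elim assms(4) by auto
      show "contraction (orth_extension D V z (C (lam k) z))"
        by (rule contraction_orth_extension[OF V z contr[OF z, unfolded N_def]])
      show "contraction (orth_extension D V w (C (lam k) w))"
        by (rule contraction_orth_extension[OF V w contr[OF w, unfolded N_def]])
      show "inv (\<lambda>h. h - lam k *\<^sub>C orth_extension D V z (C (lam k) z) h)
          = inv (\<lambda>h. h - lam k *\<^sub>C orth_extension D V w (C (lam k) w) h)"
        using R[OF z] R[OF w] by simp
    qed
    then show ?case
      by simp
  qed
  have ext_lim: "op_norm_tendsto UNIV (\<lambda>k. orth_extension D V w (C (lam k) w))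
      (orth_extension D V z L) sequentially"
    if z: "z \<in> ball 0 1 - {0}" and w: "w \<in> ball 0 1 - {0}"
      and L: "op_norm_tendsto (N z) (\<lambda>k. C (lam k) z) L sequentially" for z w L
  proof (rule op_norm_tendsto_cong[OF same[OF z w] complex_vector.subspace_UNIV])
    show "op_norm_tendsto UNIV (\<lambda>k. orth_extension D V z (C (lam k) z))
        (orth_extension D V z L) sequentially"
      by (rule op_norm_tendsto_orth_extension[OF V z contr[OF z, unfolded N_def]
            lim_contr[OF z L, unfolded N_def] L[unfolded N_def]])
  qed
  obtain L0 where L0: "op_norm_tendsto (N z0) (\<lambda>k. C (lam k) z0) L0 sequentially"
    using assms(8) by (auto simp: N_def)
  have "\<exists>L. op_norm_tendsto (N z) (\<lambda>k. C (lam k) z) L sequentially"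
    if z: "z \<in> ball 0 1 - {0}" for z
    unfolding N_def
    by (rule exI, rule op_norm_tendsto_parameter[OF V z contr[OF z, unfolded N_def]
          contraction_orth_extension[OF V assms(7) lim_contr[OF assms(7) L0, unfolded N_def]]
          ext_lim[OF assms(7) z L0]])
  moreover have "orth_extension D V z L = orth_extension D V w L'"
    if "z \<in> ball 0 1 - {0}" "w \<in> ball 0 1 - {0}"
      "op_norm_tendsto (N z) (\<lambda>k. C (lam k) z) L sequentially"
      "op_norm_tendsto (N w) (\<lambda>k. C (lam k) w) L' sequentially" for z w L L'
    using ext_lim[OF that(1,2,3)] ext_lim[OF that(2,2,4)]
    by (rule op_norm_tendsto_UNIV_unique) simp
  ultimately show ?thesis
    using lim_contr unfolding N_def by blast
qed

end
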